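(* Let $\mathcal{S}$ be an étale inverse semigroupoid, with canonical quotient map $\pi_{\mathcal{S}}\colon\mathcal{S}\to\mathrm{IG}(\mathcal{S})$ onto its initial groupoid. Then for every étale groupoid $\mathcal{G}$ and every continuous semigroupoid homomorphism $\phi\colon\mathcal{S}\to\mathcal{G}$, there exists a unique continuous groupoid homomorphism $\psi\colon\mathrm{IG}(\mathcal{S})\to\mathcal{G}$ such that $\phi=\psi\circ\pi_{\mathcal{S}}$.
   Context: A semigroupoid is a set $\Lambda$ with $\Lambda^{[2]}\subseteq\Lambda\times\Lambda$ and a product $\Lambda^{[2]}\to\Lambda$, $(f,g)\mapsto fg$, such that for all $f,g,h$ the statements (i) $(f,g),(g,h)\in\Lambda^{[2]}$; (ii) $(f,g),(fg,h)\in\Lambda^{[2]}$; (iii) $(g,h),(f,gh)\in\Lambda^{[2]}$ are equivalent, and then $(fg)h=f(gh)$. An inverse semigroupoid $\mathcal{S}$ is a semigroupoid in which each $a$ has a unique $a^*$ with $aa^*,a^*a$ defined, $aa^*a=a$, $a^*aa^*=a^*$. It carries a (unique up to relabelling vertices) graph structure: a set $\mathcal{S}^{(0)}$ and maps $\mathfrak{s},\mathfrak{r}\colon\mathcal{S}\to\mathcal{S}^{(0)}$ with $\mathcal{S}^{(0)}=\mathfrak{s}(\mathcal{S})\cup\mathfrak{r}(\mathcal{S})$, such that $ab$ is defined iff $\mathfrak{s}(a)=\mathfrak{r}(b)$, and then $\mathfrak{s}(ab)=\mathfrak{s}(b)$, $\mathfrak{r}(ab)=\mathfrak{r}(a)$.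 It is étale if $\mathcal{S}$ and $\mathcal{S}^{(0)}$ carry topologies making $\mathfrak{s},\mathfrak{r}$, the product (on $\mathcal{S}^{(2)}=\{(a,b):\mathfrak{s}(a)=\mathfrak{r}(b)\}$) and $a\mapsto a^*$ continuous, and $\mathfrak{s}$ is a local homeomorphism. A semigroupoid homomorphism is a map $\phi$ such that if $ab$ is defined then $\phi(a)\phi(b)$ is defined and equals $\phi(ab)$. Étale groupoids are étale inverse semigroupoids with $g^*=g^{-1}$. The canonical order on $\mathcal{S}$ is $a\leq b\iff a=ba^*a$ (in particular $\mathfrak{s}(a)=\mathfrak{s}(b)$ and $\mathfrak{r}(a)=\mathfrak{r}(b)$). The germ relation $a\sim_\leq b\iff$ there is $z\in\mathcal{S}$ with $z\leq a$ and $z\leq b$ is an equivalence relation on $\mathcal{S}$. The initial groupoid is the quotient $\mathrm{IG}(\mathcal{S})=\mathcal{S}/{\sim_\leq}$, with vertex space $\mathcal{S}^{(0)}$ (original topology), $\mathfrak{s}([a])=\mathfrak{s}(a)$, $\mathfrak{r}([a])=\mathfrak{r}(a)$, product $[a][b]=[ab]$ whenever $\mathfrak{s}(a)=\mathfrak{r}(b)$, and the quotient topology. It is an étale groupoid, and $\pi_{\mathcal{S}}(a)=[a]$. *)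

theory Defs
  imports "HOL-Analysis.Analysis" "HOL-Library.FuncSet"
begin

section \<open>Semigroupoids\<close>

record 'a semigroupoid =
  arr :: "'a set"
  composable :: "('a \<times> 'a) set"
  prd :: "'a \<Rightarrow> 'a \<Rightarrow> 'a" (infixl "\<odot>\<index>" 70)

text \<open>The product \<open>prd\<close> is a total function of HOL; its values off \<open>composable\<close> are irrelevant.\<close>

locale semigroupoid =
  fixes S (structure)
  assumes composable_subset: "composable S \<subseteq> arr S \<times> arr S"
    and prd_closed: "(f, g) \<in> composable S \<Longrightarrow> f \<odot> g \<in> arr S"
    and assoc_left:
      "((f, g) \<in> composable S \<and> (g, h) \<in> composable S)
        \<longleftrightarrow> ((f, g) \<in> composable S \<and> (f \<odot> g, h) \<in> composable S)"
    and assoc_right: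
      "((f, g) \<in> composable S \<and> (g, h) \<in> composable S)
        \<longleftrightarrow> ((g, h) \<in> composable S \<and> (f, g \<odot> h) \<in> composable S)"
    and assoc:
      "(f, g) \<in> composable S \<Longrightarrow> (g, h) \<in> composable S \<Longrightarrow> (f \<odot> g) \<odot> h = f \<odot> (g \<odot> h)"

definition is_inverse :: "('a, 'm) semigroupoid_scheme \<Rightarrow> 'a \<Rightarrow> 'a \<Rightarrow> bool" where
  "is_inverse S a b \<longleftrightarrow> a \<in> arr S \<and> b \<in> arr S
    \<and> (a, b) \<in> composable S \<and> (b, a) \<in> composable S
    \<and> a \<odot>\<^bsub>S\<^esub> b \<odot>\<^bsub>S\<^esub> a = a \<and> b \<odot>\<^bsub>S\<^esub> a \<odot>\<^bsub>S\<^esub> b = b"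

definition star :: "('a, 'm) semigroupoid_scheme \<Rightarrow> 'a \<Rightarrow> 'a" where
  "star S a = (THE b. is_inverse S a b)"

locale inverse_semigroupoid = semigroupoid +
  assumes unique_inverse: "a \<in> arr S \<Longrightarrow> \<exists>!b. is_inverse S a b"

definition semigroupoid_hom ::
  "('a, 'm) semigroupoid_scheme \<Rightarrow> ('b, 'n) semigroupoid_scheme \<Rightarrow> ('a \<Rightarrow> 'b) set" where
  "semigroupoid_hom S T = {\<phi>. \<phi> \<in> arr S \<rightarrow> arr T \<and>
    (\<forall>(a, b) \<in> composable S. (\<phi> a, \<phi> b) \<in> composable T \<and> \<phi> (a \<odot>\<^bsub>S\<^esub> b) = \<phi> a \<odot>\<^bsub>T\<^esub> \<phi> b)}"

section \<open>Graph structure and topology\<close>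

record ('a, 'v) graphed_semigroupoid = "'a semigroupoid" +
  vert :: "'v set"
  src :: "'a \<Rightarrow> 'v"
  rng :: "'a \<Rightarrow> 'v"

locale graphed_semigroupoid = semigroupoid +
  assumes vert_eq: "vert S = src S ` arr S \<union> rng S ` arr S"
    and composable_iff:
      "(a, b) \<in> composable S \<longleftrightarrow> a \<in> arr S \<and> b \<in> arr S \<and> src S a = rng S b"
    and src_prd: "(a, b) \<in> composable S \<Longrightarrow> src S (a \<odot> b) = src S b"
    and rng_prd: "(a, b) \<in> composable S \<Longrightarrow> rng S (a \<odot> b) = rng S a"

record ('a, 'v) topological_semigroupoid = "('a, 'v) graphed_semigroupoid" +
  arr_top :: "'a topology"
  vert_top :: "'v topology"

definition local_homeomorphism :: "'a topology \<Rightarrow> 'b topology \<Rightarrow> ('a \<Rightarrow> 'b) \<Rightarrow> bool" where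
  "local_homeomorphism X Y f \<longleftrightarrow> f \<in> topspace X \<rightarrow> topspace Y \<and>
    (\<forall>x \<in> topspace X. \<exists>U. openin X U \<and> x \<in> U \<and> openin Y (f ` U) \<and>
      homeomorphic_map (subtopology X U) (subtopology Y (f ` U)) f)"

locale etale_inverse_semigroupoid = inverse_semigroupoid S + graphed_semigroupoid S
  for S :: "('a, 'v, 'm) topological_semigroupoid_scheme" (structure) +
  assumes topspace_arr: "topspace (arr_top S) = arr S"
    and topspace_vert: "topspace (vert_top S) = vert S"
    and continuous_src: "continuous_map (arr_top S) (vert_top S) (src S)"
    and continuous_rng: "continuous_map (arr_top S) (vert_top S) (rng S)"
    and continuous_prd:
      "continuous_map (subtopology (prod_topology (arr_top S) (arr_top S)) (composable S))
        (arr_top S) (\<lambda>(a, b). a \<odot> b)"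
    and continuous_star: "continuous_map (arr_top S) (arr_top S) (star S)"
    and local_homeomorphism_src: "local_homeomorphism (arr_top S) (vert_top S) (src S)"

section \<open>Groupoids\<close>

definition is_identity :: "('a, 'v, 'm) graphed_semigroupoid_scheme \<Rightarrow> 'v \<Rightarrow> 'a \<Rightarrow> bool" where
  "is_identity G v u \<longleftrightarrow> u \<in> arr G \<and> src G u = v \<and> rng G u = v
    \<and> (\<forall>a \<in> arr G. rng G a = v \<longrightarrow> u \<odot>\<^bsub>G\<^esub> a = a)
    \<and> (\<forall>a \<in> arr G. src G a = v \<longrightarrow> a \<odot>\<^bsub>G\<^esub> u = a)"

locale groupoid = graphed_semigroupoid G for G (structure) +
  assumes identities: "v \<in> vert G \<Longrightarrow> \<exists>u. is_identity G v u"
    and inverses: "g \<in> arr G \<Longrightarrow> \<exists>h \<in> arr G. src G h = rng G g \<and> rng G h = src G g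
      \<and> is_identity G (rng G g) (g \<odot> h) \<and> is_identity G (src G g) (h \<odot> g)"

text \<open>
  The groupoid inverse of \<open>g\<close> satisfies \<open>is_inverse G g\<close>, so in the next locale it is
  \<open>star G g\<close>.
\<close>

locale etale_groupoid = etale_inverse_semigroupoid G + groupoid G
  for G :: "('a, 'v, 'm) topological_semigroupoid_scheme" (structure)

text \<open>
  A groupoid homomorphism is a semigroupoid homomorphism between groupoids (it automatically
  preserves identities and inverses), so a single notion of continuous homomorphism serves both.
\<close>

definition continuous_hom ::
  "('a, 'v, 'm) topological_semigroupoid_scheme \<Rightarrow> ('b, 'w, 'n) topological_semigroupoid_scheme
    \<Rightarrow> ('a \<Rightarrow> 'b) set" where
  "continuous_hom S T =
    {\<phi>. \<phi> \<in> semigroupoid_hom S T \<and> continuous_map (arr_top S) (arr_top T) \<phi>}"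

section \<open>The initial groupoid\<close>

definition canonical_le :: "('a, 'm) semigroupoid_scheme \<Rightarrow> 'a \<Rightarrow> 'a \<Rightarrow> bool" where
  "canonical_le S a b \<longleftrightarrow> a \<in> arr S \<and> b \<in> arr S \<and>
    (b, star S a \<odot>\<^bsub>S\<^esub> a) \<in> composable S \<and> a = b \<odot>\<^bsub>S\<^esub> (star S a \<odot>\<^bsub>S\<^esub> a)"

definition germ_rel :: "('a, 'm) semigroupoid_scheme \<Rightarrow> ('a \<times> 'a) set" where
  "germ_rel S = {(a, b). \<exists>z \<in> arr S. canonical_le S z a \<and> canonical_le S z b}"

definition germ :: "('a, 'm) semigroupoid_scheme \<Rightarrow> 'a \<Rightarrow> 'a set" where
  "germ S a = germ_rel S `` {a}"

text \<open>
  Source, range and product are constant on representatives, which is what makes \<open>the_elem\<close>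
  and the union below return the common value.
\<close>

definition initial_groupoid ::
  "('a, 'v) topological_semigroupoid \<Rightarrow> ('a set, 'v) topological_semigroupoid" where
  "initial_groupoid S =
    \<lparr> arr = arr S // germ_rel S,
      composable = {(germ S a, germ S b) | a b. a \<in> arr S \<and> b \<in> arr S \<and> src S a = rng S b},
      prd = (\<lambda>X Y. \<Union>a \<in> X. \<Union>b \<in> Y. germ S (a \<odot>\<^bsub>S\<^esub> b)),
      vert = vert S,
      src = (\<lambda>X. the_elem (src S ` X)),
      rng = (\<lambda>X. the_elem (rng S ` X)),
      arr_top = topology (\<lambda>U. U \<subseteq> arr S // germ_rel S \<and>
        openin (arr_top S) {a \<in> arr S. germ S a \<in> U}),
      vert_top = vert_top S \<rparr>"

lemma openin_initial_groupoid:
  "openin (arr_top (initial_groupoid S)) U \<longleftrightarrow>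
    U \<subseteq> arr S // germ_rel S \<and> openin (arr_top S) {a \<in> arr S. germ S a \<in> U}"
proof -
  let ?P = "\<lambda>U. {a \<in> arr S. germ S a \<in> U}"
  have "istopology (\<lambda>U. U \<subseteq> arr S // germ_rel S \<and> openin (arr_top S) (?P U))"
    unfolding istopology_def
  proof (intro conjI allI impI)
    fix U V
    assume *: "U \<subseteq> arr S // germ_rel S \<and> openin (arr_top S) (?P U)"
      and **: "V \<subseteq> arr S // germ_rel S \<and> openin (arr_top S) (?P V)"
    from * ** show "U \<inter> V \<subseteq> arr S // germ_rel S" by blast
    note * **
    moreover have "?P (U \<inter> V) = ?P U \<inter> ?P V" by blast
    ultimately show "openin (arr_top S) (?P (U \<inter> V))"
      by (simp only: openin_Int)
  next
    fix K
    assume K: "\<forall>U \<in> K. U \<subseteq> arr S // germ_rel S \<and> openin (arr_top S) (?P U)"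
    then show "\<Union>K \<subseteq> arr S // germ_rel S" by blast
    have "openin (arr_top S) (\<Union>(?P ` K))"
      by (rule openin_Union) (use K in blast)
    moreover have "?P (\<Union>K) = \<Union>(?P ` K)" by blast
    ultimately show "openin (arr_top S) (?P (\<Union>K))" by (simp only:)
  qed
  from topology_inverse'[OF this] show ?thesis
    by (simp only: initial_groupoid_def topological_semigroupoid.select_convs)
qed

lemma quotient_map_germ:
  assumes top: "topspace (arr_top S) = arr S"
  shows "quotient_map (arr_top S) (arr_top (initial_groupoid S)) (germ S)"
proof -
  have img: "germ S ` arr S = arr S // germ_rel S"
    unfolding quotient_def germ_def by blast
  then have "{a \<in> arr S. germ S a \<in> arr S // germ_rel S} = arr S" by blast
  then have "openin (arr_top (initial_groupoid S)) (arr S // germ_rel S)"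
    unfolding openin_initial_groupoid using openin_topspace[of "arr_top S"] top
    by (metis order_refl)
  then have "topspace (arr_top (initial_groupoid S)) = arr S // germ_rel S"
    by (meson openin_initial_groupoid openin_subset openin_topspace subset_antisym)
  then show ?thesis
    unfolding quotient_map_def openin_initial_groupoid top img by blast
qed

end

theory Submission
  imports Defs
begin

text \<open>
  In an inverse semigroupoid, \<open>z \<le> a\<close> means that \<open>z = a e\<close> for some idempotent \<open>e\<close>. A homomorphism
  sends idempotents to idempotents, and in a groupoid the only idempotents are the identities, since
  one may cancel in \<open>e e = e\<close>. Hence a homomorphism \<open>\<phi>\<close> into a groupoid satisfies
  \<open>\<phi> z = \<phi> a \<phi> e = \<phi> a\<close> whenever \<open>z \<le> a\<close>; it takes the same value on any two elements with a common
  lower bound, that is, on each germ. The map that it induces on germs is continuous because \<open>germ S\<close>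
  is a quotient map, and it is the only possible one because \<open>germ S\<close> is onto.

  What remains is that the product of germs, a union over all representatives, really is the germ of
  a product, so that the induced map is multiplicative. For this, germs must be equivalence classes,
  and the germ relation must be compatible with products. Both facts come from the commutation of
  idempotents (\<open>idempotents_commute\<close>): it yields the description of \<open>\<le>\<close> by idempotents
  (\<open>canonical_le_iff\<close>), a common lower bound \<open>a e f\<close> for any \<open>a e, a f \<le> a\<close>
  (\<open>equiv_germ_rel\<close>), and the possibility of moving an idempotent past an arrow, \<open>e b = b (b\<^sup>* e b)\<close>
  (\<open>canonical_le_prd\<close>).
\<close>

section \<open>Idempotents and the canonical order\<close>

context graphed_semigroupoid
begin

text \<open>
  Composability is decided by sources and ranges, so the semigroupoid laws become conditional
  rewrite rules whose side conditions the simplifier can discharge.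
\<close>

lemma prd_simps [simp]:
  assumes "a \<in> arr S" "b \<in> arr S" "src S a = rng S b"
  shows "a \<odot> b \<in> arr S" "src S (a \<odot> b) = src S b" "rng S (a \<odot> b) = rng S a"
  using assms prd_closed src_prd rng_prd composable_iff by auto

lemma prd_assoc:
  assumes "a \<in> arr S" "b \<in> arr S" "c \<in> arr S" "src S a = rng S b" "src S b = rng S c"
  shows "(a \<odot> b) \<odot> c = a \<odot> (b \<odot> c)"
  using assms assoc composable_iff by simp

definition idempotent :: "'a \<Rightarrow> bool" where
  "idempotent e \<longleftrightarrow> e \<in> arr S \<and> src S e = rng S e \<and> e \<odot> e = e"

lemma idempotentD:
  assumes "idempotent e"
  shows "e \<in> arr S" "src S e = rng S e" "e \<odot> e = e"
  using assms by (simp_all add: idempotent_def)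

lemma idempotent_absorb:
  assumes "idempotent e" "x \<in> arr S" "rng S e = rng S x"
  shows "e \<odot> (e \<odot> x) = e \<odot> x"
  using assms prd_assoc[of e e x] by (simp add: idempotent_def)

lemma is_inverse_iff:
  "is_inverse S a b \<longleftrightarrow> a \<in> arr S \<and> b \<in> arr S \<and> src S a = rng S b \<and> src S b = rng S a
    \<and> a \<odot> (b \<odot> a) = a \<and> b \<odot> (a \<odot> b) = b"
  by (auto simp: is_inverse_def composable_iff prd_assoc)

lemma idempotent_is_inverse_self: "idempotent e \<Longrightarrow> is_inverse S e e"
  by (simp add: is_inverse_iff idempotent_def)

end

locale graphed_inverse_semigroupoid = inverse_semigroupoid S + graphed_semigroupoid S
  for S :: "('a, 'v, 'm) graphed_semigroupoid_scheme" (structure)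
begin

lemma inverse_unique: "is_inverse S a b \<Longrightarrow> is_inverse S a c \<Longrightarrow> b = c"
  using unique_inverse is_inverse_iff by blast

lemma star_is_inverse: "a \<in> arr S \<Longrightarrow> is_inverse S a (star S a)"
  unfolding star_def by (rule theI') (rule unique_inverse)

lemma star_eq: "is_inverse S a b \<Longrightarrow> star S a = b"
  using inverse_unique star_is_inverse is_inverse_iff by blast

lemma star_simps [simp]:
  assumes "a \<in> arr S"
  shows "star S a \<in> arr S" "src S (star S a) = rng S a" "rng S (star S a) = src S a"
    "a \<odot> (star S a \<odot> a) = a" "star S a \<odot> (a \<odot> star S a) = star S a"
  using star_is_inverse[OF assms] by (auto simp: is_inverse_iff)

lemma star_cancel:
  assumes "a \<in> arr S" "x \<in> arr S" "src S a = rng S x"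
  shows "a \<odot> (star S a \<odot> (a \<odot> x)) = a \<odot> x"
proof -
  have "(a \<odot> (star S a \<odot> a)) \<odot> x = a \<odot> (star S a \<odot> (a \<odot> x))"
    using assms by (simp add: prd_assoc del: star_simps(4))
  then show ?thesis using assms by simp
qed

lemma idempotent_star_prd: "a \<in> arr S \<Longrightarrow> idempotent (star S a \<odot> a)"
  by (simp add: idempotent_def prd_assoc)

lemma idempotent_prd_star: "a \<in> arr S \<Longrightarrow> idempotent (a \<odot> star S a)"
  by (simp add: idempotent_def prd_assoc)

text \<open>
  For \<open>x\<close> the inverse of \<open>e f\<close>, the element \<open>f x e\<close> is also inverse to \<open>e f\<close>, whence \<open>x = f x e\<close>.
  This form makes \<open>x\<close> idempotent, hence its own inverse, and so \<open>e f = x\<close>.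
\<close>

lemma idempotent_prd:
  assumes e: "idempotent e" and f: "idempotent f" and ef: "src S e = rng S f"
  shows "idempotent (e \<odot> f)"
proof -
  note E = idempotentD[OF e] note F = idempotentD[OF f]
  let ?x = "star S (e \<odot> f)"
  have ar: "e \<odot> f \<in> arr S" using E F ef by simp
  note X = star_simps[OF ar]
  have 1: "e \<odot> (f \<odot> (?x \<odot> (e \<odot> f))) = e \<odot> f"
    using X E F ef by (simp add: prd_assoc del: star_simps(4,5))
  have 2: "?x \<odot> (e \<odot> (f \<odot> ?x)) = ?x"
    using X E F ef by (simp add: prd_assoc del: star_simps(4,5))
  have xe: "?x \<odot> (e \<odot> (f \<odot> (?x \<odot> e))) = ?x \<odot> e"
  proof -
    have "(?x \<odot> (e \<odot> (f \<odot> ?x))) \<odot> e = ?x \<odot> (e \<odot> (f \<odot> (?x \<odot> e)))"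
      using X(1-3) E(1,2) F(1,2) ef by (simp add: prd_assoc)
    then show ?thesis unfolding 2 by simp
  qed
  have "is_inverse S (e \<odot> f) (f \<odot> (?x \<odot> e))"
    unfolding is_inverse_iff
    using X(1-3) E F ef
    by (simp add: prd_assoc idempotent_absorb[OF e] idempotent_absorb[OF f] 1 xe)
  then have x: "?x = f \<odot> (?x \<odot> e)" by (rule star_eq)
  have "(f \<odot> (?x \<odot> e)) \<odot> (f \<odot> (?x \<odot> e)) = f \<odot> (?x \<odot> e)"
    using X(1-3) E F ef by (simp add: prd_assoc xe)
  then have "?x \<odot> ?x = ?x" unfolding x[symmetric] .
  then have "idempotent ?x"
    using X(1-3) E F ef by (simp add: idempotent_def)
  moreover have "is_inverse S ?x (e \<odot> f)"
    using star_is_inverse[OF ar] unfolding is_inverse_iff by blast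
  ultimately show ?thesis
    using inverse_unique idempotent_is_inverse_self by metis
qed

text \<open>Both \<open>e f\<close>, being idempotent, and \<open>f e\<close> are inverse to \<open>e f\<close>.\<close>

lemma idempotents_commute:
  assumes e: "idempotent e" and f: "idempotent f" and ef: "src S e = rng S f"
  shows "e \<odot> f = f \<odot> e"
proof -
  note E = idempotentD[OF e] note F = idempotentD[OF f]
  have 1: "e \<odot> (f \<odot> (e \<odot> f)) = e \<odot> f"
    using idempotent_prd[OF e f ef] E F ef by (simp add: idempotent_def prd_assoc)
  have 2: "f \<odot> (e \<odot> (f \<odot> e)) = f \<odot> e"
    using idempotent_prd[OF f e] E F ef by (simp add: idempotent_def prd_assoc)
  have "is_inverse S (e \<odot> f) (f \<odot> e)"
    unfolding is_inverse_iff using E F ef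
    by (simp add: prd_assoc idempotent_absorb[OF e] idempotent_absorb[OF f] 1 2)
  then show ?thesis
    using inverse_unique idempotent_is_inverse_self[OF idempotent_prd[OF e f ef]] by metis
qed

text \<open>
  Given \<open>z = a e\<close>, the element \<open>e a\<^sup>*\<close> is the inverse of \<open>z\<close>, and therefore
  \<open>a z\<^sup>* z = a e a\<^sup>* a e = a a\<^sup>* a e e = z\<close>.
\<close>

lemma canonical_le_iff:
  "canonical_le S z a \<longleftrightarrow> a \<in> arr S \<and> (\<exists>e. idempotent e \<and> src S a = rng S e \<and> z = a \<odot> e)"
    (is "?L \<longleftrightarrow> ?R")
proof
  assume ?L
  then show ?R
    using idempotent_star_prd[of z] unfolding canonical_le_def composable_iff by blast
next
  assume ?R
  then obtain e where a: "a \<in> arr S" and e: "idempotent e" and ae: "src S a = rng S e"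
    and z: "z = a \<odot> e" by blast
  note E = idempotentD[OF e]
  let ?d = "star S a \<odot> a"
  have d: "idempotent ?d" using a by (rule idempotent_star_prd)
  have comm: "e \<odot> ?d = ?d \<odot> e"
    using idempotents_commute[OF e d] a E ae by simp
  have comm': "e \<odot> (star S a \<odot> (a \<odot> e)) = star S a \<odot> (a \<odot> e)"
  proof -
    have "e \<odot> (?d \<odot> e) = (e \<odot> ?d) \<odot> e" using a E ae by (simp add: prd_assoc)
    also have "\<dots> = ?d \<odot> e" unfolding comm using a E ae by (simp add: prd_assoc)
    finally show ?thesis using a E ae by (simp add: prd_assoc)
  qed
  have "e \<odot> (star S a \<odot> (a \<odot> (e \<odot> star S a))) = e \<odot> star S a"
  proof -
    have "e \<odot> (star S a \<odot> (a \<odot> (e \<odot> star S a))) = (e \<odot> (star S a \<odot> (a \<odot> e))) \<odot> star S a"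
      using a E ae by (simp add: prd_assoc)
    also have "\<dots> = (?d \<odot> e) \<odot> star S a"
      unfolding comm' using a E ae by (simp add: prd_assoc)
    also have "\<dots> = (e \<odot> ?d) \<odot> star S a" unfolding comm ..
    also have "\<dots> = e \<odot> star S a" using a E ae by (simp add: prd_assoc)
    finally show ?thesis .
  qed
  then have "is_inverse S z (e \<odot> star S a)"
    unfolding is_inverse_iff z using a E ae
    by (simp add: prd_assoc idempotent_absorb[OF e] comm' star_cancel)
  then have "star S z = e \<odot> star S a" by (rule star_eq)
  then show ?L
    unfolding canonical_le_def z using a E ae
    by (simp add: composable_iff prd_assoc idempotent_absorb[OF e] comm' star_cancel)
qed

lemma canonical_leD:
  assumes "canonical_le S z a"
  shows "z \<in> arr S" "a \<in> arr S" "src S z = src S a" "rng S z = rng S a"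
  using assms by (auto simp: canonical_le_iff idempotent_def)

lemma canonical_le_refl: "a \<in> arr S \<Longrightarrow> canonical_le S a a"
  by (simp add: canonical_le_def composable_iff)

lemma canonical_le_trans:
  assumes "canonical_le S x y" "canonical_le S y z"
  shows "canonical_le S x z"
proof -
  obtain e f where e: "idempotent e" and f: "idempotent f" and z: "z \<in> arr S" "src S z = rng S f"
    and y: "y = z \<odot> f" and ef: "src S y = rng S e" and x: "x = y \<odot> e"
    using assms by (auto simp: canonical_le_iff)
  note E = idempotentD[OF e] note F = idempotentD[OF f]
  have fe: "src S f = rng S e" using y ef z F by simp
  have "x = z \<odot> (f \<odot> e)" using x y z E F fe by (simp add: prd_assoc)
  moreover have "src S z = rng S (f \<odot> e)" using z E F fe by simp
  ultimately show ?thesis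
    using z idempotent_prd[OF f e fe] canonical_le_iff by blast
qed

text \<open>
  If \<open>z = a e\<close> and \<open>w = b f\<close>, then \<open>e b = e b b\<^sup>* b = b b\<^sup>* e b\<close> moves \<open>e\<close> to the right:
  \<open>z w = a b (b\<^sup>* e b) f\<close>, and \<open>b\<^sup>* e b\<close> is idempotent.
\<close>

lemma canonical_le_prd:
  assumes "canonical_le S z a" "canonical_le S w b" and ab: "src S a = rng S b"
  shows "canonical_le S (z \<odot> w) (a \<odot> b)"
proof -
  obtain e f where a: "a \<in> arr S" and b: "b \<in> arr S" and e: "idempotent e" and f: "idempotent f"
    and ae: "src S a = rng S e" and bf: "src S b = rng S f"
    and z: "z = a \<odot> e" and w: "w = b \<odot> f"
    using assms by (auto simp: canonical_le_iff)
  note E = idempotentD[OF e] note F = idempotentD[OF f]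
  let ?g = "star S b \<odot> (e \<odot> b)"
  have comm: "e \<odot> (b \<odot> star S b) = (b \<odot> star S b) \<odot> e"
    using idempotents_commute[OF e idempotent_prd_star[OF b]] b E ae ab by simp
  have move: "e \<odot> b = b \<odot> ?g"
  proof -
    have "e \<odot> b = (e \<odot> (b \<odot> star S b)) \<odot> b" using b E ae ab by (simp add: prd_assoc)
    also have "\<dots> = b \<odot> ?g" unfolding comm using b E ae ab by (simp add: prd_assoc)
    finally show ?thesis .
  qed
  have "?g \<odot> ?g = star S b \<odot> (e \<odot> (b \<odot> ?g))"
    using b E ae ab by (simp add: prd_assoc)
  also have "\<dots> = ?g"
    unfolding move[symmetric] using b E ae ab by (simp add: idempotent_absorb[OF e])
  finally have g: "idempotent ?g" using b E ae ab by (simp add: idempotent_def)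
  have gf: "src S ?g = rng S f" using b E ae ab bf by simp
  have "z \<odot> w = a \<odot> ((e \<odot> b) \<odot> f)"
    unfolding z w using a b E F ae ab bf by (simp add: prd_assoc)
  also have "\<dots> = a \<odot> ((b \<odot> ?g) \<odot> f)"
    by (simp only: move[symmetric])
  also have "\<dots> = (a \<odot> b) \<odot> (?g \<odot> f)"
    using a b E F ae ab bf by (simp add: prd_assoc)
  finally have zw: "z \<odot> w = (a \<odot> b) \<odot> (?g \<odot> f)" .
  have "src S (a \<odot> b) = rng S (?g \<odot> f)" "a \<odot> b \<in> arr S"
    using a b E F ae ab bf by simp_all
  then show ?thesis
    using zw idempotent_prd[OF g f gf] canonical_le_iff by blast
qed

section \<open>Germs\<close>

lemma germ_relE:
  assumes "(a, b) \<in> germ_rel S"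
  obtains z where "canonical_le S z a" "canonical_le S z b"
  using assms by (auto simp: germ_rel_def)

lemma germ_relI: "canonical_le S z a \<Longrightarrow> canonical_le S z b \<Longrightarrow> (a, b) \<in> germ_rel S"
  using canonical_leD by (auto simp: germ_rel_def)

lemma germ_relD:
  assumes "(a, b) \<in> germ_rel S"
  shows "a \<in> arr S" "b \<in> arr S" "src S a = src S b" "rng S a = rng S b"
  using assms canonical_leD by (metis germ_relE)+

text \<open>
  Transitivity is the point: lower bounds \<open>b e\<close> of \<open>a, b\<close> and \<open>b f\<close> of \<open>b, c\<close> have
  the common lower bound \<open>b e f = b f e\<close>.
\<close>

lemma equiv_germ_rel: "equiv (arr S) (germ_rel S)"
proof (rule equivI)
  show "germ_rel S \<subseteq> arr S \<times> arr S" using germ_relD by auto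
  show "refl_on (arr S) (germ_rel S)"
    using germ_relD by (auto intro!: refl_onI germ_relI canonical_le_refl)
  show "sym (germ_rel S)" by (auto intro: symI simp: germ_rel_def)
  show "trans (germ_rel S)"
  proof (rule transI)
    fix a b c
    assume "(a, b) \<in> germ_rel S" "(b, c) \<in> germ_rel S"
    then obtain z w where za: "canonical_le S z a" and zb: "canonical_le S z b"
      and wb: "canonical_le S w b" and wc: "canonical_le S w c"
      by (meson germ_relE)
    obtain e f where b: "b \<in> arr S" and e: "idempotent e" and f: "idempotent f"
      and be: "src S b = rng S e" and bf: "src S b = rng S f"
      and z: "z = b \<odot> e" and w: "w = b \<odot> f"
      using zb wb by (auto simp: canonical_le_iff)
    note E = idempotentD[OF e] note F = idempotentD[OF f]
    have "z \<odot> f = b \<odot> (e \<odot> f)" using z b E F be bf by (simp add: prd_assoc)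
    also have "\<dots> = b \<odot> (f \<odot> e)" using idempotents_commute[OF e f] E be bf by simp
    also have "\<dots> = w \<odot> e" using w b E F be bf by (simp add: prd_assoc)
    finally have eq: "z \<odot> f = w \<odot> e" .
    have "canonical_le S (z \<odot> f) z" "canonical_le S (w \<odot> e) w"
      unfolding canonical_le_iff using z w b e f E F be bf by auto
    then show "(a, c) \<in> germ_rel S"
      using za wc eq by (metis germ_relI canonical_le_trans)
  qed
qed

lemma germ_eq_iff: "a \<in> arr S \<Longrightarrow> b \<in> arr S \<Longrightarrow> germ S a = germ S b \<longleftrightarrow> (a, b) \<in> germ_rel S"
  unfolding germ_def using equiv_germ_rel by (rule eq_equiv_class_iff)

lemma germ_rel_prd:
  assumes "(a, a') \<in> germ_rel S" "(b, b') \<in> germ_rel S" "src S a = rng S b"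
  shows "(a \<odot> b, a' \<odot> b') \<in> germ_rel S"
proof -
  have "src S a' = rng S b'" using assms germ_relD by metis
  then show ?thesis using assms by (meson germ_relE germ_relI canonical_le_prd)
qed

text \<open>All the germs united on the left coincide with the one on the right.\<close>

lemma Union_germ_prd:
  assumes "a \<in> arr S" "b \<in> arr S" "src S a = rng S b"
  shows "(\<Union>x \<in> germ S a. \<Union>y \<in> germ S b. germ S (x \<odot> y)) = germ S (a \<odot> b)"
proof -
  have self: "a \<in> germ S a" "b \<in> germ S b"
    using assms germ_relI canonical_le_refl unfolding germ_def by blast+
  have "germ S (x \<odot> y) = germ S (a \<odot> b)" if "x \<in> germ S a" "y \<in> germ S b" for x y
  proof -
    have "(a \<odot> b, x \<odot> y) \<in> germ_rel S"
      using that assms germ_rel_prd by (auto simp: germ_def)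
    then show ?thesis using germ_eq_iff germ_relD by metis
  qed
  then show ?thesis using self by blast
qed

end

sublocale etale_inverse_semigroupoid \<subseteq> graphed_inverse_semigroupoid
  by unfold_locales

section \<open>Homomorphisms into groupoids\<close>

text \<open>With \<open>h\<close> the inverse of \<open>e\<close>, one has \<open>e = (h e) e = h (e e) = h e\<close>, an identity.\<close>

lemma (in groupoid) idempotent_is_identity:
  assumes e: "idempotent e"
  shows "is_identity G (src G e) e"
proof -
  note E = idempotentD[OF e]
  obtain h where h: "h \<in> arr G" "src G h = rng G e" "rng G h = src G e"
    "is_identity G (src G e) (h \<odot> e)"
    using inverses E by blast
  have "(h \<odot> e) \<odot> e = e" using h E by (simp add: is_identity_def)
  moreover have "(h \<odot> e) \<odot> e = h \<odot> e" using h E by (simp add: prd_assoc)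
  ultimately show ?thesis using h by metis
qed

text \<open>
  A lower bound of \<open>a\<close> is \<open>a e\<close> with \<open>e\<close> idempotent, and \<open>\<phi> e\<close> is then an identity, so that
  the lower bound has the same image as \<open>a\<close>.
\<close>

lemma semigroupoid_hom_groupoid_germ_rel:
  fixes S :: "('a, 'v, 'm) graphed_semigroupoid_scheme"
    and G :: "('b, 'w, 'n) graphed_semigroupoid_scheme"
  assumes "graphed_inverse_semigroupoid S" "groupoid G" "\<phi> \<in> semigroupoid_hom S G"
    and germ: "(a, b) \<in> germ_rel S"
  shows "\<phi> a = \<phi> b"
proof -
  interpret S: graphed_inverse_semigroupoid S by fact
  interpret G: groupoid G by fact
  have hom: "(\<phi> x, \<phi> y) \<in> composable G \<and> \<phi> (x \<odot>\<^bsub>S\<^esub> y) = \<phi> x \<odot>\<^bsub>G\<^esub> \<phi> y"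
    if "(x, y) \<in> composable S" for x y
    using assms(3) that by (auto simp: semigroupoid_hom_def)
  have "\<phi> z = \<phi> c" if le: "canonical_le S z c" for z c
  proof -
    obtain e where c: "c \<in> arr S" "src S c = rng S e" and e: "S.idempotent e"
      and z: "z = c \<odot>\<^bsub>S\<^esub> e"
      using le by (auto simp: S.canonical_le_iff)
    note E = S.idempotentD[OF e]
    have "(e, e) \<in> composable S" using E by (simp add: S.composable_iff)
    then have "G.idempotent (\<phi> e)"
      using hom[of e e] E(3) by (auto simp: G.idempotent_def G.composable_iff)
    then have "is_identity G (src G (\<phi> e)) (\<phi> e)" "src G (\<phi> e) = rng G (\<phi> e)"
      by (blast dest: G.idempotent_is_identity G.idempotentD)+
    moreover have "(c, e) \<in> composable S" using c E by (simp add: S.composable_iff)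
    ultimately show ?thesis
      using hom[of c e] z by (auto simp: is_identity_def G.composable_iff)
  qed
  then show ?thesis using germ by (metis S.germ_relE)
qed

section \<open>The universal property\<close>

theorem proposition4p16:
  fixes S :: "('a, 'v) topological_semigroupoid"
    and G :: "('b, 'w) topological_semigroupoid"
    and \<phi> :: "'a \<Rightarrow> 'b"
  assumes "etale_inverse_semigroupoid S"
    and "etale_groupoid G"
    and "\<phi> \<in> continuous_hom S G"
  shows "\<exists>!\<psi>. \<psi> \<in> extensional (arr (initial_groupoid S)) \<and>
    \<psi> \<in> continuous_hom (initial_groupoid S) G \<and>
    (\<forall>a \<in> arr S. \<phi> a = \<psi> (germ S a))"
proof -
  interpret S: etale_inverse_semigroupoid S by fact
  interpret G: etale_groupoid G by fact
  let ?I = "initial_groupoid S"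
  have arr: "arr ?I = germ S ` arr S"
    by (auto simp: initial_groupoid_def quotient_def germ_def)
  have hom: "\<phi> \<in> semigroupoid_hom S G" and cont: "continuous_map (arr_top S) (arr_top G) \<phi>"
    using assms(3) by (auto simp: continuous_hom_def)
  define \<psi> where "\<psi> = restrict (\<lambda>X. \<phi> (SOME a. a \<in> arr S \<and> germ S a = X)) (arr ?I)"
  have val: "\<psi> (germ S a) = \<phi> a" if a: "a \<in> arr S" for a
  proof -
    let ?c = "SOME c. c \<in> arr S \<and> germ S c = germ S a"
    have c: "?c \<in> arr S \<and> germ S ?c = germ S a"
      by (rule someI[of _ a]) (simp add: a)
    then have "(?c, a) \<in> germ_rel S" using S.germ_eq_iff a by blast
    then have "\<phi> ?c = \<phi> a"
      using semigroupoid_hom_groupoid_germ_rel[OF _ _ hom]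
        S.graphed_inverse_semigroupoid_axioms G.groupoid_axioms by blast
    then show ?thesis using a by (simp add: \<psi>_def arr)
  qed
  have "\<psi> \<in> semigroupoid_hom ?I G"
  proof -
    have "\<psi> \<in> arr ?I \<rightarrow> arr G" using hom val by (auto simp: arr semigroupoid_hom_def)
    moreover have "(\<psi> X, \<psi> Y) \<in> composable G \<and> \<psi> (X \<odot>\<^bsub>?I\<^esub> Y) = \<psi> X \<odot>\<^bsub>G\<^esub> \<psi> Y"
      if XY: "(X, Y) \<in> composable ?I" for X Y
    proof -
      obtain a b where ab: "a \<in> arr S" "b \<in> arr S" "src S a = rng S b"
        and X: "X = germ S a" and Y: "Y = germ S b"
        using XY by (auto simp: initial_groupoid_def)
      have "X \<odot>\<^bsub>?I\<^esub> Y = germ S (a \<odot>\<^bsub>S\<^esub> b)"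
        using S.Union_germ_prd[OF ab] by (simp add: initial_groupoid_def X Y)
      moreover have "(a, b) \<in> composable S" using ab by (simp add: S.composable_iff)
      ultimately show ?thesis
        using hom ab by (auto simp: semigroupoid_hom_def X Y val)
    qed
    ultimately show ?thesis by (auto simp: semigroupoid_hom_def)
  qed
  moreover have "continuous_map (arr_top ?I) (arr_top G) \<psi>"
  proof (rule continuous_compose_quotient_map[OF quotient_map_germ[OF S.topspace_arr]])
    show "continuous_map (arr_top S) (arr_top G) (\<psi> \<circ> germ S)"
      by (rule continuous_map_eq[OF cont]) (simp add: val S.topspace_arr)
  qed
  ultimately have "\<psi> \<in> continuous_hom ?I G" by (simp add: continuous_hom_def)
  moreover have "\<psi> \<in> extensional (arr ?I)" by (simp add: \<psi>_def)
  moreover have "\<psi>' = \<psi>"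
    if ext: "\<psi>' \<in> extensional (arr ?I)" and fact: "\<forall>a \<in> arr S. \<phi> a = \<psi>' (germ S a)" for \<psi>'
    by (rule extensionalityI[OF ext \<open>\<psi> \<in> extensional (arr ?I)\<close>]) (use fact val in \<open>auto simp: arr\<close>)
  moreover have "\<forall>a \<in> arr S. \<phi> a = \<psi> (germ S a)" by (simp add: val)
  ultimately show ?thesis by blast
qed

end
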